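(* Fix a number $p\geq 1$, $p\notin 2\mathbb{N}$. Let $\|\cdot\|$ be a norm in $\mathbb{R}^n$ whose restriction to $\mathbb{S}^{n-1}$ is of class $C^{2r}$, where $r\in\mathbb{N}$ and $2r>n+p$. Then $(\mathbb{R}^n,\|\cdot\|)$ does not embed isometrically in $\ell_p$.
   Context: Here $p$ is a real number, and $p\notin 2\mathbb{N}$ means that $p$ is not an even (positive) integer. All vector spaces are over $\mathbb{R}$, and all isometries are linear. $\mathbb{S}^{n-1}=\{u\in\mathbb{R}^n:\|u\|_2=1\}$ is the unit sphere of $\mathbb{R}^n$, where $\|\cdot\|_2$ is the Euclidean norm. $\ell_p$ denotes the space of real sequences $x=(x_j)_{j=1}^\infty$ with $\sum_j|x_j|^p<\infty$ and norm $\|x\|_p=\left(\sum_j|x_j|^p\right)^{1/p}$. A normed space $(X,\|\cdot\|_X)$ embeds isometrically in $\ell_p$ if there is a linear map $T:X\to\ell_p$ with $\|Tx\|_p=\|x\|_X$ for all $x\in X$.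
   Formalization: The formal statement assumes n ≥ 2; for n = 1 the claim fails, since every norm is c|x|, is trivially smooth on the two-point sphere, and embeds isometrically in ℓ_p by x ↦ (cx, 0, 0, …). *)

theory Defs
  imports "HOL-Analysis.Analysis"
begin

definition is_norm :: "('a::real_vector \<Rightarrow> real) \<Rightarrow> bool" where
  "is_norm N \<longleftrightarrow>
     (\<forall>x. 0 \<le> N x) \<and>
     (\<forall>x. N x = 0 \<longleftrightarrow> x = 0) \<and>
     (\<forall>c x. N (c *\<^sub>R x) = \<bar>c\<bar> * N x) \<and>
     (\<forall>x y. N (x + y) \<le> N x + N y)"

(* Only meaningful for open U: the derivative is taken with respect to the whole space. *)
primrec Ck_on :: "nat \<Rightarrow> 'a::euclidean_space set \<Rightarrow> ('a \<Rightarrow> real) \<Rightarrow> bool" where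
  "Ck_on 0 U f \<longleftrightarrow> continuous_on U f"
| "Ck_on (Suc k) U f \<longleftrightarrow>
     (\<forall>x\<in>U. f differentiable (at x)) \<and>
     (\<forall>v. Ck_on k U (\<lambda>x. frechet_derivative f (at x) v))"

(* Class C^k on an embedded submanifold S (here the sphere): locally the restriction of a
   C^k function on an open subset of the ambient space.  Only the values of f on S matter. *)
definition Ck_on_submanifold ::
    "nat \<Rightarrow> 'a::euclidean_space set \<Rightarrow> ('a \<Rightarrow> real) \<Rightarrow> bool" where
  "Ck_on_submanifold k S f \<longleftrightarrow>
     (\<forall>x\<in>S. \<exists>U g. open U \<and> x \<in> U \<and> Ck_on k U g \<and> (\<forall>y\<in>S \<inter> U. g y = f y))"

definition ell :: "real \<Rightarrow> (nat \<Rightarrow> real) set" where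
  "ell p = {x. summable (\<lambda>j. \<bar>x j\<bar> powr p)}"

definition ell_norm :: "real \<Rightarrow> (nat \<Rightarrow> real) \<Rightarrow> real" where
  "ell_norm p x = (\<Sum>j. \<bar>x j\<bar> powr p) powr (1 / p)"

(* Linearity is spelled out pointwise because functions are not an instance of real_vector. *)
definition embeds_isometrically_in_ell :: "('a::real_vector \<Rightarrow> real) \<Rightarrow> real \<Rightarrow> bool" where
  "embeds_isometrically_in_ell N p \<longleftrightarrow>
     (\<exists>T :: 'a \<Rightarrow> nat \<Rightarrow> real.
        (\<forall>x. T x \<in> ell p) \<and>
        (\<forall>x y. T (x + y) = (\<lambda>j. T x j + T y j)) \<and>
        (\<forall>c x. T (c *\<^sub>R x) = (\<lambda>j. c * T x j)) \<and>
        (\<forall>x. ell_norm p (T x) = N x))"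

end

theory Submission
  imports Defs
begin

text \<open>Suppose \<open>T\<close> embeds the space isometrically. Choose a line \<open>x + s u\<close> missing the origin on which
  some coordinate of \<open>T\<close> vanishes exactly at \<open>s = 0\<close>. Along it, the \<open>p\<close>-th power of the norm is
  \<open>\<Sum>\<bar>\<alpha>\<^sub>j + s \<beta>\<^sub>j\<bar> powr p\<close> with \<open>\<alpha>\<^sub>m = 0 \<noteq> \<beta>\<^sub>m\<close>. Write \<open>p = 2 k + q\<close> with \<open>0 < q < 2\<close>; differentiating \<open>2 k\<close>
  times gives, up to a constant, \<open>g(s) = \<Sum>\<beta>\<^sub>j ^ (2 k) \<bar>\<alpha>\<^sub>j + s \<beta>\<^sub>j\<bar> powr q\<close>, a function of class \<open>C\<^sup>2\<close>
  near \<open>0\<close>. Integrate its second difference at \<open>0\<close> against \<open>t powr (- q - 2)\<close> over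
  \<open>[\<delta>, \<eta>]\<close>. The integral is \<open>o(1 / \<delta>)\<close> because \<open>g\<close> is \<open>C\<^sup>2\<close>. On the other hand the
  contribution of each term is bounded below by a summable sequence independent of \<open>\<delta>\<close>, and the
  \<open>m\<close>-th term contributes a positive multiple of \<open>1 / \<delta> - 1 / \<eta>\<close>, a contradiction.\<close>

subsection \<open>Signed powers and their second differences\<close>

text \<open>Differentiating a power of an absolute value produces a sign. This family is closed
  under differentiation: up to a constant, each derivative raises \<open>i\<close> by one and lowers
  \<open>a\<close> by one.\<close>

definition signed_powr :: "nat \<Rightarrow> real \<Rightarrow> real \<Rightarrow> real" where
  "signed_powr i a x = sgn x ^ i * \<bar>x\<bar> powr a"

lemma abs_signed_powr: "\<bar>signed_powr i a x\<bar> \<le> \<bar>x\<bar> powr a"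
  by (cases "x = 0") (auto simp: signed_powr_def abs_mult power_abs)

lemma signed_powr_even: "even i \<Longrightarrow> signed_powr i a x = \<bar>x\<bar> powr a"
  by (cases "x = 0") (auto simp: signed_powr_def sgn_if)

lemma signed_powr_minus: "signed_powr 1 a (- x) = - signed_powr 1 a x"
  by (simp add: signed_powr_def)

text \<open>Off \<open>0\<close> the function agrees near \<open>x\<close> with a constant times a
  power of \<open>sgn x * y\<close>. At \<open>0\<close> the difference quotient is at most
  \<open>\<bar>h\<bar> powr (a - 1)\<close>, which tends to \<open>0\<close> because
  \<open>1 < a\<close>.\<close>

lemma DERIV_signed_powr:
  assumes "1 < a"
  shows "(signed_powr i a has_real_derivative a * signed_powr (Suc i) (a - 1) x) (at x)"
proof (cases "x = 0")
  case True
  have "((\<lambda>h::real. \<bar>h\<bar> powr (a - 1)) \<longlongrightarrow> \<bar>0\<bar> powr (a - 1)) (at 0)"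
    using assms by (intro tendsto_intros) auto
  then have "((\<lambda>h::real. \<bar>h\<bar> powr (a - 1)) \<longlongrightarrow> 0) (at 0)"
    by simp
  moreover have "norm ((signed_powr i a h - signed_powr i a 0) / h) \<le> \<bar>h\<bar> powr (a - 1)"
    if "h \<noteq> 0" for h
  proof -
    have "\<bar>h\<bar> powr (a - 1) = \<bar>h\<bar> powr a / \<bar>h\<bar>"
      using that by (simp add: powr_diff)
    moreover have "\<bar>signed_powr i a h\<bar> / \<bar>h\<bar> \<le> \<bar>h\<bar> powr a / \<bar>h\<bar>"
      by (intro divide_right_mono abs_signed_powr) auto
    ultimately show ?thesis
      by (simp add: signed_powr_def)
  qed
  then have "eventually (\<lambda>h. norm ((signed_powr i a h - signed_powr i a 0) / h)
      \<le> \<bar>h\<bar> powr (a - 1)) (at 0)"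
    by (auto simp: eventually_at_filter)
  ultimately have "((\<lambda>h. (signed_powr i a h - signed_powr i a 0) / h) \<longlongrightarrow> 0) (at 0)"
    by (rule Lim_null_comparison[rotated])
  with True show ?thesis
    by (simp add: DERIV_def signed_powr_def)
next
  case False
  have "((\<lambda>y. (sgn x * y) powr a) has_real_derivative
      a * (sgn x * x) powr (a - of_nat 1) * sgn x) (at x)"
    using False by (intro DERIV_fun_powr DERIV_cmult_Id) (simp add: sgn_if)
  from DERIV_cmult[OF this, of "sgn x ^ i"]
  have "((\<lambda>y. sgn x ^ i * (sgn x * y) powr a) has_real_derivative
      a * signed_powr (Suc i) (a - 1) x) (at x)"
    by (simp add: signed_powr_def abs_sgn mult_ac)
  moreover have "eventually (\<lambda>y. sgn x ^ i * (sgn x * y) powr a = signed_powr i a y) (nhds x)"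
  proof -
    have "eventually (\<lambda>y. y \<in> (if x > 0 then {0<..} else {..<0})) (nhds x)"
      using False by (intro eventually_nhds_in_open) auto
    then show ?thesis
      by (rule eventually_mono) (use False in \<open>auto simp: signed_powr_def sgn_if split: if_splits\<close>)
  qed
  ultimately show ?thesis
    by (subst (asm) DERIV_cong_ev[OF refl _ refl]) assumption+
qed

lemmas DERIV_signed_powr_chain = DERIV_signed_powr[THEN DERIV_chain2]

text \<open>Both sides agree at \<open>b = 0\<close> and the right side is even in \<open>b\<close>.
  For \<open>b \<ge> 0\<close> its \<open>b\<close>-derivative is a positive multiple of
  \<open>\<bar>y + b\<bar> powr q - \<bar>y - b\<bar> powr q\<close>, which is nonnegative since
  \<open>y \<ge> 0\<close>.\<close>

lemma second_difference_signed_powr_nonneg: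
  assumes "0 < q" "0 \<le> y"
  shows "2 * signed_powr 1 (q + 1) y
    \<le> signed_powr 1 (q + 1) (y + b) + signed_powr 1 (q + 1) (y - b)"
proof -
  define F where "F b = signed_powr 1 (q + 1) (y + b) + signed_powr 1 (q + 1) (y - b)" for b
  have "F 0 \<le> F \<bar>b\<bar>"
  proof (rule DERIV_nonneg_imp_nondecreasing[where f = F])
    fix t :: real
    assume t: "0 \<le> t" "t \<le> \<bar>b\<bar>"
    have "(F has_real_derivative (q + 1) * (\<bar>y + t\<bar> powr q - \<bar>y - t\<bar> powr q)) (at t)"
      unfolding F_def
      by (rule derivative_eq_intros DERIV_signed_powr_chain refl
          | use assms in \<open>simp add: signed_powr_even algebra_simps\<close>)+
    moreover have "\<bar>y - t\<bar> powr q \<le> \<bar>y + t\<bar> powr q"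
      using assms t by (intro powr_mono2) auto
    ultimately show "\<exists>d. (F has_real_derivative d) (at t) \<and> 0 \<le> d"
      using assms by (intro exI[of _ "(q + 1) * (\<bar>y + t\<bar> powr q - \<bar>y - t\<bar> powr q)"]) auto
  qed simp
  then show ?thesis
    by (cases "0 \<le> b") (simp_all add: F_def add.commute)
qed

text \<open>The second difference vanishes at \<open>y = 0\<close> by oddness, and its derivative on
  \<open>[0, y]\<close> is at most \<open>2 * (q + 1) * (y + \<bar>b\<bar>) powr q\<close>. The
  factor \<open>y\<close> gained here later cancels a division by
  \<open>\<bar>a\<bar>\<close>.\<close>

lemma second_difference_signed_powr_le:
  assumes "0 < q" "0 \<le> y"
  shows "signed_powr 1 (q + 1) (y + b) + signed_powr 1 (q + 1) (y - b) - 2 * signed_powr 1 (q + 1) y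
    \<le> 2 * (q + 1) * (y + \<bar>b\<bar>) powr q * y"
proof -
  define F where "F x = 2 * (q + 1) * (y + \<bar>b\<bar>) powr q * x - (signed_powr 1 (q + 1) (x + b)
    + signed_powr 1 (q + 1) (x - b) - 2 * signed_powr 1 (q + 1) x)" for x
  have "F 0 \<le> F y"
  proof (rule DERIV_nonneg_imp_nondecreasing[where f = F])
    fix t :: real
    assume t: "0 \<le> t" "t \<le> y"
    let ?d = "(q + 1) * (2 * (y + \<bar>b\<bar>) powr q -
      (\<bar>t + b\<bar> powr q + \<bar>t - b\<bar> powr q - 2 * \<bar>t\<bar> powr q))"
    have "(F has_real_derivative ?d) (at t)"
      unfolding F_def
      by (rule derivative_eq_intros DERIV_signed_powr_chain refl
          | use assms in \<open>simp add: signed_powr_even algebra_simps\<close>)+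
    moreover have "\<bar>t - b\<bar> powr q \<le> (y + \<bar>b\<bar>) powr q" "\<bar>t + b\<bar> powr q \<le> (y + \<bar>b\<bar>) powr q"
      using assms t by (auto intro!: powr_mono2)
    then have "0 \<le> 2 * (y + \<bar>b\<bar>) powr q - (\<bar>t + b\<bar> powr q + \<bar>t - b\<bar> powr q - 2 * \<bar>t\<bar> powr q)"
      using powr_ge_zero[of "\<bar>t\<bar>" q] by linarith
    ultimately show "\<exists>d. (F has_real_derivative d) (at t) \<and> 0 \<le> d"
      using assms by (intro exI[of _ ?d]) auto
  qed fact
  moreover have "F 0 = 0"
    using signed_powr_minus[of "q + 1" b] by (simp add: F_def) (simp add: signed_powr_def)
  ultimately show ?thesis
    by (simp add: F_def)
qed

text \<open>The weight \<open>t powr (- q - 2)\<close> is the one of the fractional Laplacian that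
  sends \<open>\<bar>t\<bar> powr q\<close> to a multiple of the Dirac measure at \<open>0\<close>.\<close>

lemma has_integral_powr_weighted:
  fixes b q :: real
  assumes "0 < \<delta>" "\<delta> \<le> \<eta>"
  shows "((\<lambda>t. \<bar>t * b\<bar> powr q * t powr (- q - 2)) has_integral
    \<bar>b\<bar> powr q * (1 / \<delta> - 1 / \<eta>)) {\<delta>..\<eta>}"
proof -
  define F where "F t = - (\<bar>b\<bar> powr q * (1 / t))" for t :: real
  have "((\<lambda>t. \<bar>t * b\<bar> powr q * t powr (- q - 2)) has_integral (F \<eta> - F \<delta>)) {\<delta>..\<eta>}"
  proof (rule fundamental_theorem_of_calculus)
    fix t assume t: "t \<in> {\<delta>..\<eta>}"
    then have "t > 0"
      using assms by auto
    have e: "\<bar>t * b\<bar> powr q * t powr (- q - 2) = \<bar>b\<bar> powr q * (1 / t ^ 2)"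
      using \<open>t > 0\<close> by (simp add: abs_mult powr_mult powr_diff powr_minus divide_simps)
    have D: "(F has_real_derivative \<bar>b\<bar> powr q * (1 / t ^ 2)) (at t)"
      unfolding F_def
      by (rule derivative_eq_intros refl | use \<open>t > 0\<close> in \<open>simp add: power2_eq_square\<close>)+
    then show "(F has_vector_derivative \<bar>t * b\<bar> powr q * t powr (- q - 2)) (at t within {\<delta>..\<eta>})"
      unfolding e has_real_derivative_iff_has_vector_derivative[symmetric]
      by (rule has_field_derivative_at_within)
  qed fact
  then show ?thesis
    by (simp add: F_def algebra_simps)
qed

text \<open>For \<open>a \<noteq> 0\<close>, the substitution \<open>x = \<bar>a\<bar> / t\<close>
  absorbs the weight and leaves a second difference of \<open>\<bar>x\<bar> powr q\<close> with
  constant step \<open>b\<close>, whose antiderivative is explicit. The endpoint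
  \<open>\<delta>\<close> contributes a nonnegative amount, so the lower bound involves only
  \<open>\<eta>\<close>.\<close>

lemma has_integral_second_difference:
  fixes a b q :: real
  assumes "0 < q" "0 < \<delta>" "\<delta> \<le> \<eta>"
  obtains I where
    "((\<lambda>t. (\<bar>a + t * b\<bar> powr q + \<bar>a - t * b\<bar> powr q - 2 * \<bar>a\<bar> powr q) * t powr (- q - 2))
      has_integral I) {\<delta>..\<eta>}"
    "- (2 / \<eta> * (\<bar>a\<bar> / \<eta> + \<bar>b\<bar>) powr q) \<le> I"
proof (cases "a = 0")
  case True
  have "0 \<le> 2 * (\<bar>b\<bar> powr q * (1 / \<delta> - 1 / \<eta>))"
    using assms by (auto simp: frac_le)
  moreover have "- (2 / \<eta> * (\<bar>a\<bar> / \<eta> + \<bar>b\<bar>) powr q) \<le> 0"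
    using assms by auto
  ultimately show ?thesis
    using that[of "2 * (\<bar>b\<bar> powr q * (1 / \<delta> - 1 / \<eta>))"] True
      has_integral_mult_right[OF has_integral_powr_weighted[OF assms(2,3), of b q], of 2]
    by (simp add: mult.assoc)
next
  case False
  define c where "c = \<bar>a\<bar>"
  have "c > 0"
    using False by (simp add: c_def)
  let ?S = "signed_powr 1 (q + 1)"
  define E where "E t = (?S (c / t + b) + ?S (c / t - b) - 2 * ?S (c / t)) / ((q + 1) * c)" for t
  \<comment> \<open>Changing the sign of \<open>a\<close> only swaps the two shifted terms. Passing
    to \<open>c\<close> makes \<open>c / t\<close> nonnegative, as the two preceding inequalities
    require.\<close>
  have sym: "\<bar>a + t * b\<bar> powr q + \<bar>a - t * b\<bar> powr q = \<bar>c + t * b\<bar> powr q + \<bar>c - t * b\<bar> powr q" for t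
    using abs_minus_commute[of "- a" "t * b"] abs_minus_commute[of a "t * b"]
    by (cases "0 \<le> a") (simp_all add: c_def add.commute)
  have "((\<lambda>t. (\<bar>a + t * b\<bar> powr q + \<bar>a - t * b\<bar> powr q - 2 * \<bar>a\<bar> powr q) * t powr (- q - 2))
      has_integral (- E \<eta> - - E \<delta>)) {\<delta>..\<eta>}"
  proof (rule fundamental_theorem_of_calculus)
    fix t assume t: "t \<in> {\<delta>..\<eta>}"
    then have "t > 0"
      using assms by auto
    have sc: "\<bar>x / t\<bar> powr q / t ^ 2 = \<bar>x\<bar> powr q * t powr (- q - 2)" for x
      using \<open>t > 0\<close> by (simp add: abs_mult powr_divide powr_diff powr_minus divide_simps)
    let ?d = "(\<bar>c / t + b\<bar> powr q + \<bar>c / t - b\<bar> powr q - 2 * \<bar>c / t\<bar> powr q) / t ^ 2"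
    have "((\<lambda>t. - E t) has_real_derivative
        - (((q + 1) * \<bar>c / t + b\<bar> powr q * (- (c / t ^ 2)) + (q + 1) * \<bar>c / t - b\<bar> powr q * (- (c / t ^ 2))
          - 2 * ((q + 1) * \<bar>c / t\<bar> powr q * (- (c / t ^ 2)))) / ((q + 1) * c))) (at t)"
      unfolding E_def
      by (rule derivative_eq_intros DERIV_signed_powr_chain refl
          | use assms \<open>c > 0\<close> \<open>t > 0\<close> in \<open>simp add: signed_powr_even power2_eq_square\<close>)+
    also have "- (((q + 1) * \<bar>c / t + b\<bar> powr q * (- (c / t ^ 2)) + (q + 1) * \<bar>c / t - b\<bar> powr q * (- (c / t ^ 2))
          - 2 * ((q + 1) * \<bar>c / t\<bar> powr q * (- (c / t ^ 2)))) / ((q + 1) * c)) = ?d"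
    proof -
      have "- ((k * u * (- (c / s)) + k * v * (- (c / s)) - 2 * (k * w * (- (c / s)))) / (k * c))
        = (u + v - 2 * w) / s" if "k > 0" "s > 0" for k u v w s
        using that \<open>c > 0\<close> by (simp add: field_simps)
      then show ?thesis
        using assms \<open>t > 0\<close> by auto
    qed
    also have "?d = (\<bar>a + t * b\<bar> powr q + \<bar>a - t * b\<bar> powr q - 2 * \<bar>a\<bar> powr q) * t powr (- q - 2)"
    proof -
      have "c / t + b = (c + t * b) / t" "c / t - b = (c - t * b) / t"
        using \<open>t > 0\<close> by (simp_all add: field_simps)
      then have "?d = (\<bar>c + t * b\<bar> powr q + \<bar>c - t * b\<bar> powr q - 2 * \<bar>c\<bar> powr q) * t powr (- q - 2)"
        using sc[of "c + t * b"] sc[of "c - t * b"] sc[of c]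
        by (simp add: diff_divide_distrib add_divide_distrib algebra_simps del: abs_divide)
      then show ?thesis
        by (simp add: sym c_def)
    qed
    finally show "((\<lambda>t. - E t) has_vector_derivative
        (\<bar>a + t * b\<bar> powr q + \<bar>a - t * b\<bar> powr q - 2 * \<bar>a\<bar> powr q) * t powr (- q - 2))
        (at t within {\<delta>..\<eta>})"
      unfolding has_real_derivative_iff_has_vector_derivative[symmetric]
      by (rule has_field_derivative_at_within)
  qed fact
  moreover have "0 \<le> E \<delta>"
    using second_difference_signed_powr_nonneg[of q "c / \<delta>" b] assms \<open>c > 0\<close>
    by (simp add: E_def)
  moreover have "E \<eta> \<le> 2 / \<eta> * (\<bar>a\<bar> / \<eta> + \<bar>b\<bar>) powr q"
  proof -
    have "E \<eta> \<le> 2 * (q + 1) * (c / \<eta> + \<bar>b\<bar>) powr q * (c / \<eta>) / ((q + 1) * c)"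
      unfolding E_def using assms \<open>c > 0\<close>
      by (intro divide_right_mono second_difference_signed_powr_le) auto
    also have "\<dots> = 2 / \<eta> * (\<bar>a\<bar> / \<eta> + \<bar>b\<bar>) powr q"
    proof -
      have "2 * k * w * (c / h) / (k * c) = 2 / h * w" if "k > 0" for k w h
        using that \<open>c > 0\<close> by simp
      from this[of "q + 1"] show ?thesis
        using assms(1) unfolding c_def[symmetric] by simp
    qed
    finally show ?thesis .
  qed
  ultimately show ?thesis
    using that[of "- E \<eta> - - E \<delta>"] by simp
qed

subsection \<open>Continuously differentiable functions on the real line\<close>

text \<open>One-dimensional counterpart of \<open>Ck_on\<close>. The derivative is an existential
  witness, so the product and chain rules can supply it by an explicit formula.\<close>

fun Ck_real :: "nat \<Rightarrow> real set \<Rightarrow> (real \<Rightarrow> real) \<Rightarrow> bool" where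
  "Ck_real 0 V h \<longleftrightarrow> continuous_on V h"
| "Ck_real (Suc k) V h \<longleftrightarrow>
     (\<exists>h'. (\<forall>x\<in>V. (h has_real_derivative h' x) (at x)) \<and> Ck_real k V h')"

lemma Ck_real_SucI:
  "\<lbrakk>\<And>x. x \<in> V \<Longrightarrow> (h has_real_derivative h' x) (at x); Ck_real k V h'\<rbrakk> \<Longrightarrow> Ck_real (Suc k) V h"
  by auto

lemma Ck_real_SucE:
  assumes "Ck_real (Suc k) V h"
  obtains h' where "\<And>x. x \<in> V \<Longrightarrow> (h has_real_derivative h' x) (at x)" "Ck_real k V h'"
  using assms by auto

lemma Ck_real_SucD: "Ck_real (Suc k) V h \<Longrightarrow> Ck_real k V h"
proof (induction k arbitrary: h)
  case 0
  then show ?case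
    using DERIV_isCont by (auto intro!: continuous_at_imp_continuous_on)
next
  case (Suc k)
  from Suc.prems obtain h' where h': "\<And>x. x \<in> V \<Longrightarrow> (h has_real_derivative h' x) (at x)" "Ck_real (Suc k) V h'"
    by (rule Ck_real_SucE) blast
  show ?case
    using h'(1) Suc.IH[OF h'(2)] by (rule Ck_real_SucI)
qed

lemma Ck_real_mono: "Ck_real k V h \<Longrightarrow> j \<le> k \<Longrightarrow> Ck_real j V h"
proof (induction k)
  case (Suc k)
  then show ?case
    using Ck_real_SucD by (metis le_Suc_eq)
qed simp

lemma Ck_real_cong:
  assumes "open V" "\<And>x. x \<in> V \<Longrightarrow> h x = g x"
  shows "Ck_real k V h \<longleftrightarrow> Ck_real k V g"
proof (cases k)
  case 0
  then show ?thesis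
    using assms by (auto cong: continuous_on_cong)
next
  case (Suc m)
  have "(h has_real_derivative d) (at x) \<longleftrightarrow> (g has_real_derivative d) (at x)" if "x \<in> V" for d x
    using assms that
    by (intro DERIV_cong_ev) (auto simp: eventually_nhds)
  then show ?thesis
    using Suc by auto
qed

text \<open>Uniqueness of derivatives transfers the regularity of the witness to any explicitly
  known derivative, such as a series differentiated term by term.\<close>

lemma Ck_real_derivative:
  assumes "open V" "Ck_real (Suc k) V h" "\<And>x. x \<in> V \<Longrightarrow> (h has_real_derivative g x) (at x)"
  shows "Ck_real k V g"
proof -
  from assms(2) obtain h' where h': "\<And>x. x \<in> V \<Longrightarrow> (h has_real_derivative h' x) (at x)" "Ck_real k V h'"
    by (rule Ck_real_SucE) blast
  have "h' x = g x" if "x \<in> V" for x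
    using h'(1) assms(3) that DERIV_unique by blast
  then show ?thesis
    using Ck_real_cong[OF assms(1), of h' g k] h'(2) by blast
qed

lemma Ck_real_const: "Ck_real k V (\<lambda>_. c)"
proof (induction k arbitrary: c)
  case (Suc k)
  then show ?case
    by (auto intro!: exI[of _ "\<lambda>_. 0"])
qed simp

lemma Ck_real_ident: "Ck_real k V (\<lambda>x. x)"
proof (cases k)
  case (Suc m)
  then show ?thesis
    by (auto intro!: exI[of _ "\<lambda>_. 1"] Ck_real_const)
qed simp

lemma Ck_real_add:
  "Ck_real k V f \<Longrightarrow> Ck_real k V g \<Longrightarrow> Ck_real k V (\<lambda>x. f x + g x)"
proof (induction k arbitrary: f g)
  case (Suc k)
  from Suc.prems obtain f' g' where
    "\<And>x. x \<in> V \<Longrightarrow> (f has_real_derivative f' x) (at x)" "Ck_real k V f'"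
    "\<And>x. x \<in> V \<Longrightarrow> (g has_real_derivative g' x) (at x)" "Ck_real k V g'"
    by (metis Ck_real_SucE)
  with Suc.IH[of f' g'] show ?case
    by (intro Ck_real_SucI[where h' = "\<lambda>x. f' x + g' x"] DERIV_add)
qed (simp add: continuous_on_add)

lemma Ck_real_mult:
  "Ck_real k V f \<Longrightarrow> Ck_real k V g \<Longrightarrow> Ck_real k V (\<lambda>x. f x * g x)"
proof (induction k arbitrary: f g)
  case (Suc k)
  from Suc.prems obtain f' g' where d:
    "\<And>x. x \<in> V \<Longrightarrow> (f has_real_derivative f' x) (at x)" "Ck_real k V f'"
    "\<And>x. x \<in> V \<Longrightarrow> (g has_real_derivative g' x) (at x)" "Ck_real k V g'"
    by (metis Ck_real_SucE)
  have "Ck_real k V (\<lambda>x. f' x * g x + g' x * f x)"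
    using Suc.prems[THEN Ck_real_SucD] d by (intro Ck_real_add Suc.IH)
  with d show ?case
    by (intro Ck_real_SucI[where h' = "\<lambda>x. f' x * g x + g' x * f x"] DERIV_mult)
qed (simp add: continuous_on_mult)

lemma Ck_real_powr:
  assumes "Ck_real k V h" "\<And>x. x \<in> V \<Longrightarrow> 0 < h x"
  shows "Ck_real k V (\<lambda>x. h x powr a)"
  using assms(1)
proof (induction k arbitrary: a)
  case 0
  have "\<forall>x\<in>V. h x \<noteq> 0"
    using assms(2) by force
  with 0 show ?case
    by (auto intro!: continuous_on_powr)
next
  case (Suc k)
  from Suc.prems obtain h' where h': "\<And>x. x \<in> V \<Longrightarrow> (h has_real_derivative h' x) (at x)" "Ck_real k V h'"
    by (rule Ck_real_SucE) blast
  have "Ck_real k V (\<lambda>x. a * h x powr (a - of_nat 1) * h' x)"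
    using Suc.prems[THEN Ck_real_SucD] h'(2) by (intro Ck_real_mult Ck_real_const Suc.IH)
  then show ?case
    using h'(1) assms(2)
    by (intro Ck_real_SucI[where h' = "\<lambda>x. a * h x powr (a - of_nat 1) * h' x"] DERIV_fun_powr)
qed

text \<open>The curve stays in the span of \<open>x\<close> and \<open>y\<close>, so its image under
  \<open>G\<close> has a derivative that combines \<open>A'\<close> and \<open>B'\<close> with the
  directional derivatives of \<open>G\<close> along these two fixed vectors. The induction
  hypothesis applies to each of them.\<close>

lemma Ck_real_comp_Ck_on:
  assumes "Ck_on k U G" "Ck_real k V A" "Ck_real k V B"
    and "\<And>s. s \<in> V \<Longrightarrow> A s *\<^sub>R x + B s *\<^sub>R y \<in> U"
  shows "Ck_real k V (\<lambda>s. G (A s *\<^sub>R x + B s *\<^sub>R y))"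
  using assms(1-3)
proof (induction k arbitrary: G)
  case 0
  have c: "continuous_on V (\<lambda>s. A s *\<^sub>R x + B s *\<^sub>R y)"
    using 0 by (intro continuous_intros) auto
  then show ?case
    using 0 assms(4) continuous_on_compose2[OF _ c, of U G] by auto
next
  case (Suc k)
  from Suc.prems obtain A' B' where d:
    "\<And>s. s \<in> V \<Longrightarrow> (A has_real_derivative A' s) (at s)" "Ck_real k V A'"
    "\<And>s. s \<in> V \<Longrightarrow> (B has_real_derivative B' s) (at s)" "Ck_real k V B'"
    by (metis Ck_real_SucE)
  let ?\<gamma> = "\<lambda>s. A s *\<^sub>R x + B s *\<^sub>R y"
  let ?D = "\<lambda>v s. frechet_derivative G (at (?\<gamma> s)) v"
  have D: "Ck_real k V (?D v)" for v
    using Suc.prems by (intro Suc.IH[of "\<lambda>z. frechet_derivative G (at z) v"] Ck_real_SucD[of k]) auto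
  have "Ck_real k V (\<lambda>s. A' s * ?D x s + B' s * ?D y s)"
    by (rule Ck_real_add[OF Ck_real_mult[OF d(2) D] Ck_real_mult[OF d(4) D]])
  moreover have "((\<lambda>s. G (?\<gamma> s)) has_real_derivative A' s * ?D x s + B' s * ?D y s) (at s)"
    if "s \<in> V" for s
  proof -
    have G: "(G has_derivative frechet_derivative G (at (?\<gamma> s))) (at (?\<gamma> s))"
      using Suc.prems(1) assms(4)[OF that] by (simp add: frechet_derivative_works)
    interpret G: bounded_linear "frechet_derivative G (at (?\<gamma> s))"
      using G by (rule has_derivative_bounded_linear)
    have "(?\<gamma> has_derivative (\<lambda>h. (A' s * h) *\<^sub>R x + (B' s * h) *\<^sub>R y)) (at s)"
      using d(1,3)[OF that]
      by (intro has_derivative_add has_derivative_scaleR_left)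
         (simp_all add: has_field_derivative_def)
    from has_derivative_compose[OF this G]
    have "((\<lambda>s. G (?\<gamma> s)) has_derivative (\<lambda>h. ?D ((A' s * h) *\<^sub>R x + (B' s * h) *\<^sub>R y) s)) (at s)" .
    moreover have "(\<lambda>h. ?D ((A' s * h) *\<^sub>R x + (B' s * h) *\<^sub>R y) s) = (*) (A' s * ?D x s + B' s * ?D y s)"
      by (simp add: fun_eq_iff G.add G.scaleR algebra_simps)
    ultimately show ?thesis
      by (simp only: has_field_derivative_def)
  qed
  ultimately show ?case
    by (rule Ck_real_SucI[rotated])
qed

text \<open>A bound \<open>M\<close> for the second derivative on a compact interval is integrated
  twice. The condition \<open>\<eta> \<le> 1\<close> serves the later majorants and comparisons of
  powers of \<open>t\<close>.\<close>

lemma second_difference_le_square: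
  assumes "open V" "0 \<in> V" "Ck_real 2 V g"
  obtains \<eta> M where "0 < \<eta>" "\<eta> \<le> 1"
    "\<And>t. 0 \<le> t \<Longrightarrow> t \<le> \<eta> \<Longrightarrow> g t + g (- t) - 2 * g 0 \<le> M * t ^ 2"
proof -
  from assms(3) obtain g1 g2 where
    g1: "\<And>x. x \<in> V \<Longrightarrow> (g has_real_derivative g1 x) (at x)" and
    g2: "\<And>x. x \<in> V \<Longrightarrow> (g1 has_real_derivative g2 x) (at x)" and
    "continuous_on V g2"
    by (auto simp: numeral_2_eq_2)
  obtain e where e: "e > 0" "cball 0 e \<subseteq> V"
    using assms(1,2) open_contains_cball by blast
  define \<eta> where "\<eta> = min e 1"
  have \<eta>: "0 < \<eta>" "\<eta> \<le> 1" "{- \<eta>..\<eta>} \<subseteq> V"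
    using e by (auto simp: \<eta>_def cball_def dist_real_def subset_iff)
  have "compact (g2 ` {- \<eta>..\<eta>})"
    using \<open>continuous_on V g2\<close> \<eta>(3) continuous_on_subset by (intro compact_continuous_image) auto
  then obtain M where M: "\<And>x. x \<in> {- \<eta>..\<eta>} \<Longrightarrow> \<bar>g2 x\<bar> \<le> M"
    using compact_imp_bounded by (force simp: bounded_iff)
  have D1: "g1 t - g1 (- t) \<le> 2 * M * t" if t: "0 \<le> t" "t \<le> \<eta>" for t
  proof -
    have "(\<lambda>x. M * x - g1 x) (- t) \<le> (\<lambda>x. M * x - g1 x) t"
    proof (rule DERIV_nonneg_imp_nondecreasing[where f = "\<lambda>x. M * x - g1 x"])
      fix x assume "- t \<le> x" "x \<le> t"
      then have x: "x \<in> {- \<eta>..\<eta>}"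
        using t by auto
      then have "((\<lambda>x. M * x - g1 x) has_real_derivative M - g2 x) (at x)"
        using \<eta>(3) by (intro DERIV_diff DERIV_cmult_Id g2) auto
      moreover have "0 \<le> M - g2 x"
        using M[OF x] by auto
      ultimately show "\<exists>d. ((\<lambda>x. M * x - g1 x) has_real_derivative d) (at x) \<and> 0 \<le> d"
        by blast
    qed (use t in auto)
    then show ?thesis
      by simp
  qed
  have "g t + g (- t) - 2 * g 0 \<le> M * t ^ 2" if t: "0 \<le> t" "t \<le> \<eta>" for t
  proof -
    define F where "F x = M * x ^ 2 - (g x + g (- x))" for x
    have "F 0 \<le> F t"
    proof (rule DERIV_nonneg_imp_nondecreasing[where f = F])
      fix x assume x: "0 \<le> x" "x \<le> t"
      then have "x \<in> V" "- x \<in> V"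
        using t \<eta>(3) by auto
      then have "(g has_real_derivative g1 x) (at x)"
        by (intro g1)
      moreover have "((\<lambda>x. g (- x)) has_real_derivative g1 (- x) * (- 1)) (at x)"
        using g1[OF \<open>- x \<in> V\<close>] by (rule DERIV_chain2) (auto intro!: derivative_eq_intros)
      moreover have "((\<lambda>x. M * x ^ 2) has_real_derivative M * (2 * x)) (at x)"
        by (auto intro!: derivative_eq_intros)
      ultimately have "(F has_real_derivative M * (2 * x) - (g1 x + g1 (- x) * (- 1))) (at x)"
        unfolding F_def by (intro DERIV_diff DERIV_add)
      moreover have "0 \<le> M * (2 * x) - (g1 x + g1 (- x) * (- 1))"
        using D1[of x] x t by auto
      ultimately show "\<exists>d. (F has_real_derivative d) (at x) \<and> 0 \<le> d"
        by blast
    qed (use t in auto)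
    then show ?thesis
      by (simp add: F_def)
  qed
  with that \<eta> show ?thesis
    by blast
qed

subsection \<open>Sums of powers of affine functions\<close>

text \<open>A sum is at most twice its larger summand. This provides the majorant for every series
  below.\<close>

lemma summable_powr_add:
  fixes \<alpha> \<beta> :: "nat \<Rightarrow> real"
  assumes "0 < p" "0 \<le> c" "summable (\<lambda>j. \<bar>\<alpha> j\<bar> powr p)" "summable (\<lambda>j. \<bar>\<beta> j\<bar> powr p)"
  shows "summable (\<lambda>j. (\<bar>\<alpha> j\<bar> + c * \<bar>\<beta> j\<bar>) powr p)"
proof (rule summable_comparison_test')
  show "summable (\<lambda>j. 2 powr p * (\<bar>\<alpha> j\<bar> powr p + c powr p * \<bar>\<beta> j\<bar> powr p))"
    using assms by (intro summable_mult summable_add)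
next
  fix j
  define x where "x = \<bar>\<alpha> j\<bar>"
  define y where "y = c * \<bar>\<beta> j\<bar>"
  have nn: "0 \<le> x" "0 \<le> y"
    using assms by (auto simp: x_def y_def)
  then have "(x + y) powr p \<le> (2 * max x y) powr p"
    using assms by (intro powr_mono2) auto
  also have "\<dots> = 2 powr p * max x y powr p"
    using nn by (simp add: powr_mult)
  also have "\<dots> \<le> 2 powr p * (x powr p + y powr p)"
    by (intro mult_left_mono) (auto simp: max_def)
  also have "y powr p = c powr p * \<bar>\<beta> j\<bar> powr p"
    using assms by (simp add: y_def powr_mult)
  finally show "norm ((\<bar>\<alpha> j\<bar> + c * \<bar>\<beta> j\<bar>) powr p)
      \<le> 2 powr p * (\<bar>\<alpha> j\<bar> powr p + c powr p * \<bar>\<beta> j\<bar> powr p)"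
    by (simp add: x_def y_def)
qed

lemma power_mult_powr_le:
  fixes z :: real
  assumes "\<bar>b\<bar> \<le> z" "\<bar>x\<bar> \<le> z" "real i \<le> p"
  shows "\<bar>b\<bar> ^ i * \<bar>x\<bar> powr (p - real i) \<le> z powr p"
proof (cases "z = 0")
  case False
  then have "z > 0"
    using assms(1) by linarith
  then have "\<bar>b\<bar> ^ i * \<bar>x\<bar> powr (p - real i) \<le> z ^ i * z powr (p - real i)"
    using assms by (intro mult_mono power_mono powr_mono2) auto
  also have "\<dots> = z powr p"
    using \<open>z > 0\<close> by (simp add: powr_add[symmetric] flip: powr_realpow)
  finally show ?thesis .
qed (use assms in auto)

text \<open>The term is homogeneous of degree \<open>p\<close> in \<open>(a, b)\<close>, so one
  majorant serves all orders \<open>i\<close> and all \<open>s\<close> in the range. The condition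
  \<open>1 \<le> R\<close> also lets it dominate the factors \<open>\<bar>b\<bar>\<close>.\<close>

lemma abs_line_term_le:
  assumes "1 \<le> R" "\<bar>s\<bar> \<le> R" "real i \<le> p"
  shows "\<bar>b ^ i * signed_powr i (p - real i) (a + s * b)\<bar> \<le> (\<bar>a\<bar> + R * \<bar>b\<bar>) powr p"
proof -
  have "1 * \<bar>b\<bar> \<le> R * \<bar>b\<bar>" "\<bar>s\<bar> * \<bar>b\<bar> \<le> R * \<bar>b\<bar>"
    using assms by (intro mult_right_mono; simp)+
  moreover have "\<bar>a + s * b\<bar> \<le> \<bar>a\<bar> + \<bar>s\<bar> * \<bar>b\<bar>"
    using abs_triangle_ineq[of a "s * b"] by (simp add: abs_mult)
  ultimately have "\<bar>b\<bar> \<le> \<bar>a\<bar> + R * \<bar>b\<bar>" "\<bar>a + s * b\<bar> \<le> \<bar>a\<bar> + R * \<bar>b\<bar>"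
    using abs_ge_zero[of a] by linarith+
  then have "\<bar>b\<bar> ^ i * \<bar>a + s * b\<bar> powr (p - real i) \<le> (\<bar>a\<bar> + R * \<bar>b\<bar>) powr p"
    using assms by (intro power_mult_powr_le)
  moreover have "\<bar>b ^ i * signed_powr i (p - real i) (a + s * b)\<bar>
      \<le> \<bar>b\<bar> ^ i * \<bar>a + s * b\<bar> powr (p - real i)"
    unfolding abs_mult power_abs by (intro mult_left_mono abs_signed_powr) auto
  ultimately show ?thesis
    by linarith
qed

lemma DERIV_line_series:
  fixes \<alpha> \<beta> :: "nat \<Rightarrow> real"
  assumes "summable (\<lambda>j. \<bar>\<alpha> j\<bar> powr p)" "summable (\<lambda>j. \<bar>\<beta> j\<bar> powr p)" "real (Suc i) < p"
  shows "((\<lambda>s. \<Sum>j. \<beta> j ^ i * signed_powr i (p - real i) (\<alpha> j + s * \<beta> j)) has_real_derivative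
    (p - real i) * (\<Sum>j. \<beta> j ^ Suc i * signed_powr (Suc i) (p - real (Suc i)) (\<alpha> j + s * \<beta> j))) (at s)"
proof -
  \<comment> \<open>This makes \<open>s\<close> an interior point of \<open>[-R, R]\<close>, where
    the Weierstrass test justifies termwise differentiation, and ensures
    \<open>1 \<le> R\<close>.\<close>
  define R where "R = \<bar>s\<bar> + 1"
  let ?f = "\<lambda>j x. \<beta> j ^ i * signed_powr i (p - real i) (\<alpha> j + x * \<beta> j)"
  let ?g = "\<lambda>j x. \<beta> j ^ Suc i * signed_powr (Suc i) (p - real (Suc i)) (\<alpha> j + x * \<beta> j)"
  have sum: "summable (\<lambda>j. (\<bar>\<alpha> j\<bar> + R * \<bar>\<beta> j\<bar>) powr p)"
    using assms by (intro summable_powr_add) (auto simp: R_def)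
  have g_le: "norm (?g j x) \<le> (\<bar>\<alpha> j\<bar> + R * \<bar>\<beta> j\<bar>) powr p" if "x \<in> {- R..R}" for j x
    using that assms(3) unfolding real_norm_def by (intro abs_line_term_le) (auto simp: R_def)
  have "((\<lambda>s. \<Sum>j. ?f j s) has_real_derivative (\<Sum>j. (p - real i) * ?g j s)) (at s)"
  proof (rule has_field_derivative_series'(2)[of "{- R..R}"])
    fix j x assume "x \<in> {- R..R}"
    have "1 < p - real i"
      using assms(3) by simp
    moreover have "((\<lambda>x. \<alpha> j + x * \<beta> j) has_real_derivative \<beta> j) (at x)"
      by (auto intro!: derivative_eq_intros)
    ultimately have "(?f j has_real_derivative \<beta> j ^ i * ((p - real i) *
        signed_powr (Suc i) (p - real i - 1) (\<alpha> j + x * \<beta> j) * \<beta> j)) (at x)"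
      by (rule DERIV_cmult[OF DERIV_signed_powr_chain])
    also have "\<beta> j ^ i * ((p - real i) *
        signed_powr (Suc i) (p - real i - 1) (\<alpha> j + x * \<beta> j) * \<beta> j) = (p - real i) * ?g j x"
      by (simp add: diff_diff_eq add.commute mult_ac)
    finally show "(?f j has_real_derivative (p - real i) * ?g j x) (at x within {- R..R})"
      by (rule has_field_derivative_at_within)
  next
    have "norm ((p - real i) * ?g j x) \<le> (p - real i) * (\<bar>\<alpha> j\<bar> + R * \<bar>\<beta> j\<bar>) powr p"
      if "x \<in> {- R..R}" for j x
      using g_le[OF that, of j] assms(3) unfolding norm_mult by (intro mult_mono) auto
    then show "uniformly_convergent_on {- R..R} (\<lambda>n x. \<Sum>j<n. (p - real i) * ?g j x)"
      by (intro Weierstrass_m_test'[OF _ summable_mult[OF sum]])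
  next
    show "summable (\<lambda>j. ?f j 0)"
    proof (rule summable_comparison_test'[OF sum])
      show "norm (?f j 0) \<le> (\<bar>\<alpha> j\<bar> + R * \<bar>\<beta> j\<bar>) powr p" for j
        using assms(3) unfolding real_norm_def by (intro abs_line_term_le) (auto simp: R_def)
    qed
  qed (auto simp: R_def)
  moreover have "(\<Sum>j. (p - real i) * ?g j s) = (p - real i) * (\<Sum>j. ?g j s)"
  proof (rule suminf_mult)
    show "summable (\<lambda>j. ?g j s)"
      by (rule summable_comparison_test'[OF sum g_le]) (auto simp: R_def)
  qed
  ultimately show ?thesis
    by (simp only:)
qed

text \<open>Each induction step spends one order of smoothness on one termwise derivative and
  divides out the nonzero constant \<open>p - real i\<close>.\<close>

lemma Ck_real_line_series:
  fixes \<alpha> \<beta> :: "nat \<Rightarrow> real"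
  assumes "summable (\<lambda>j. \<bar>\<alpha> j\<bar> powr p)" "summable (\<lambda>j. \<bar>\<beta> j\<bar> powr p)" "open V"
    and "Ck_real (m + i) V (\<lambda>s. \<Sum>j. \<bar>\<alpha> j + s * \<beta> j\<bar> powr p)" "real i < p"
  shows "Ck_real m V (\<lambda>s. \<Sum>j. \<beta> j ^ i * signed_powr i (p - real i) (\<alpha> j + s * \<beta> j))"
  using assms(4,5)
proof (induction i arbitrary: m)
  case 0
  then show ?case
    by (simp add: signed_powr_even)
next
  case (Suc i)
  let ?g = "\<lambda>s. \<Sum>j. \<beta> j ^ Suc i * signed_powr (Suc i) (p - real (Suc i)) (\<alpha> j + s * \<beta> j)"
  have "Ck_real (Suc m) V (\<lambda>s. \<Sum>j. \<beta> j ^ i * signed_powr i (p - real i) (\<alpha> j + s * \<beta> j))"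
    using Suc.prems by (intro Suc.IH) auto
  then have "Ck_real m V (\<lambda>s. (p - real i) * ?g s)"
    by (rule Ck_real_derivative[OF assms(3)])
       (rule DERIV_line_series[OF assms(1,2) Suc.prems(2)])
  then have "Ck_real m V (\<lambda>s. 1 / (p - real i) * ((p - real i) * ?g s))"
    by (rule Ck_real_mult[OF Ck_real_const])
  moreover have "1 / (p - real i) * ((p - real i) * y) = y" for y
    using Suc.prems(2) by simp
  ultimately show ?case
    by (simp only:)
qed

text \<open>The \<open>2 * k\<close>-th derivative of the \<open>m\<close>-th term is a nonzero
  multiple of \<open>\<bar>s\<bar> powr q\<close>, which is not C^2 at \<open>0\<close>. The even
  order keeps all coefficients \<open>\<beta> j ^ (2 * k)\<close> nonnegative, so the one-sided
  integral bounds prevent the other terms from cancelling this singularity.\<close>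

lemma line_series_not_Ck:
  fixes \<alpha> \<beta> :: "nat \<Rightarrow> real"
  assumes summ: "summable (\<lambda>j. \<bar>\<alpha> j\<bar> powr p)" "summable (\<lambda>j. \<bar>\<beta> j\<bar> powr p)"
    and p: "p = 2 * real k + q" "0 < q" "q < 2"
    and V: "open V" "0 \<in> V"
    and m: "\<alpha> m = 0" "\<beta> m \<noteq> 0"
  shows "\<not> Ck_real (2 * k + 2) V (\<lambda>s. \<Sum>j. \<bar>\<alpha> j + s * \<beta> j\<bar> powr p)"
proof
  assume C: "Ck_real (2 * k + 2) V (\<lambda>s. \<Sum>j. \<bar>\<alpha> j + s * \<beta> j\<bar> powr p)"

  \<comment> \<open>Reduction to a C^2 function\<close>
  define f where "f j s = \<beta> j ^ (2 * k) * \<bar>\<alpha> j + s * \<beta> j\<bar> powr q" for j s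
  define g where "g s = (\<Sum>j. f j s)" for s
  have "0 < p"
    using p by simp
  have f_eq: "\<beta> j ^ (2 * k) * signed_powr (2 * k) (p - real (2 * k)) (\<alpha> j + s * \<beta> j) = f j s" for j s
    using p(1) by (simp add: f_def signed_powr_even)
  have "Ck_real 2 V (\<lambda>s. \<Sum>j. \<beta> j ^ (2 * k) * signed_powr (2 * k) (p - real (2 * k)) (\<alpha> j + s * \<beta> j))"
    using C p by (intro Ck_real_line_series[OF summ V(1)]) (auto simp: add.commute)
  then have "Ck_real 2 V g"
    unfolding f_eq g_def .
  then obtain \<eta> M where \<eta>: "0 < \<eta>" "\<eta> \<le> 1"
    and M: "\<And>t. 0 \<le> t \<Longrightarrow> t \<le> \<eta> \<Longrightarrow> g t + g (- t) - 2 * g 0 \<le> M * t ^ 2"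
    using second_difference_le_square[OF V] by blast

  \<comment> \<open>Majorants and termwise second differences\<close>
  define B where "B j = (\<bar>\<alpha> j\<bar> + 1 * \<bar>\<beta> j\<bar>) powr p" for j
  have summ_B: "summable B"
    unfolding B_def by (intro summable_powr_add summ \<open>0 < p\<close>) auto
  have f_le: "\<bar>f j s\<bar> \<le> B j" if "\<bar>s\<bar> \<le> 1" for j s
    using abs_line_term_le[of 1 s "2 * k" p "\<beta> j" "\<alpha> j"] that p unfolding f_eq B_def by simp
  have f_summable: "summable (\<lambda>j. f j s)" if "\<bar>s\<bar> \<le> 1" for s
    by (rule summable_comparison_test'[OF summ_B]) (use f_le that in auto)

  define T where "T j t = f j t + f j (- t) - 2 * f j 0" for j t
  have T_eq: "T j t = \<beta> j ^ (2 * k) *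
      (\<bar>\<alpha> j + t * \<beta> j\<bar> powr q + \<bar>\<alpha> j - t * \<beta> j\<bar> powr q - 2 * \<bar>\<alpha> j\<bar> powr q)" for j t
    by (simp add: T_def f_def algebra_simps)
  have T_suminf: "(\<Sum>j. T j t) = g t + g (- t) - 2 * g 0" if "\<bar>t\<bar> \<le> 1" for t
  proof -
    have "(\<lambda>j. T j t) sums (g t + g (- t) - 2 * g 0)"
      unfolding T_def g_def using that
      by (intro sums_add sums_diff sums_mult summable_sums f_summable) auto
    then show ?thesis
      by (rule sums_unique[symmetric])
  qed
  have T_le: "\<bar>T j t\<bar> \<le> 4 * B j" if "\<bar>t\<bar> \<le> 1" for j t
    using f_le[of t j] f_le[of "- t" j] f_le[of 0 j] that unfolding T_def by auto

  \<comment> \<open>This is the \<open>\<delta>\<close>-free bound of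
    \<open>has_integral_second_difference\<close> times the coefficient. By homogeneity it is
    dominated by a \<open>p\<close>-th power, hence summable.\<close>
  define K where "K j = \<beta> j ^ (2 * k) * (2 / \<eta> * (\<bar>\<alpha> j\<bar> / \<eta> + \<bar>\<beta> j\<bar>) powr q)" for j
  have K_nonneg: "0 \<le> K j" for j
    using \<eta> by (simp add: K_def zero_le_even_power)
  have "summable (\<lambda>j. \<bar>\<alpha> j / \<eta>\<bar> powr p)"
    using summable_divide[OF summ(1), of "\<eta> powr p"] \<eta> by (simp add: powr_divide)
  then have "summable (\<lambda>j. (\<bar>\<alpha> j / \<eta>\<bar> + 1 * \<bar>\<beta> j\<bar>) powr p)"
    by (intro summable_powr_add summ \<open>0 < p\<close>) auto
  then have "summable (\<lambda>j. 2 / \<eta> * (\<bar>\<alpha> j / \<eta>\<bar> + 1 * \<bar>\<beta> j\<bar>) powr p)"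
    by (rule summable_mult)
  moreover have "norm (K j) \<le> 2 / \<eta> * (\<bar>\<alpha> j / \<eta>\<bar> + 1 * \<bar>\<beta> j\<bar>) powr p" for j
  proof -
    define z where "z = \<bar>\<alpha> j / \<eta>\<bar> + 1 * \<bar>\<beta> j\<bar>"
    have "\<bar>\<beta> j\<bar> ^ (2 * k) * \<bar>z\<bar> powr (p - real (2 * k)) \<le> z powr p"
      using p by (intro power_mult_powr_le) (auto simp: z_def)
    then have "2 / \<eta> * (\<bar>\<beta> j\<bar> ^ (2 * k) * \<bar>z\<bar> powr (p - real (2 * k))) \<le> 2 / \<eta> * z powr p"
      using \<eta> by (intro mult_left_mono) auto
    moreover have "2 / \<eta> * (\<bar>\<beta> j\<bar> ^ (2 * k) * \<bar>z\<bar> powr (p - real (2 * k))) = K j"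
      using p(1) \<eta> by (simp add: K_def z_def power_even_abs)
    ultimately show ?thesis
      using K_nonneg[of j] by (simp add: z_def)
  qed
  ultimately have summ_K: "summable K"
    by (rule summable_comparison_test'[where N = 0])

  define c where "c = \<beta> m ^ (2 * k) * \<bar>\<beta> m\<bar> powr q"
  have "0 < c"
    using m(2) by (simp add: c_def zero_less_power_eq)
  \<comment> \<open>Three properties are wanted: \<open>\<theta> \<ge> q\<close>, so that
    \<open>t powr (- q) \<le> t powr (- \<theta>)\<close> on \<open>(0, 1]\<close>;
    \<open>\<theta> > 1\<close>, so that the integral is a power of \<open>\<delta>\<close> even
    when \<open>q \<le> 1\<close>; and \<open>\<theta> < 2\<close>, so that \<open>\<delta>\<close>
    times that power tends to \<open>0\<close>.\<close>
  define \<theta> where "\<theta> = max q (3 / 2)"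
  have \<theta>: "1 < \<theta>" "\<theta> < 2" "q \<le> \<theta>"
    using p by (auto simp: \<theta>_def)
  define L where "L = \<bar>M\<bar> / (\<theta> - 1)"

  \<comment> \<open>The lower and upper bounds for the weighted integral \<open>J\<close> are
    compared and multiplied by \<open>\<delta>\<close>.\<close>
  have bound: "2 * c \<le> (2 * c / \<eta> + suminf K) * \<delta> + L * \<delta> powr (2 - \<theta>)"
    if \<delta>: "0 < \<delta>" "\<delta> < \<eta>" for \<delta>
  proof -
    let ?w = "\<lambda>t::real. t powr (- q - 2)"

    \<comment> \<open>Interchange of sum and integral\<close>
    have "uniform_limit {\<delta>..\<eta>} (\<lambda>n t. \<Sum>j<n. T j t * ?w t) (\<lambda>t. \<Sum>j. T j t * ?w t) sequentially"
    \<comment> \<open>Away from \<open>0\<close> the weight is bounded by its value at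
      \<open>\<delta>\<close>, so the majorant \<open>B\<close> gives uniform convergence.\<close>
    proof (rule Weierstrass_m_test[where M = "\<lambda>j. 4 * B j * ?w \<delta>"])
      show "norm (T j t * ?w t) \<le> 4 * B j * ?w \<delta>" if "t \<in> {\<delta>..\<eta>}" for j t
      proof -
        have "?w t \<le> ?w \<delta>"
          using that \<delta> p by (intro powr_mono2') auto
        moreover have "\<bar>T j t\<bar> \<le> 4 * B j"
          using that \<delta> \<eta> by (intro T_le) auto
        ultimately have "\<bar>T j t\<bar> * ?w t \<le> 4 * B j * ?w \<delta>"
          by (intro mult_mono) auto
        then show ?thesis
          by (simp add: abs_mult)
      qed
      show "summable (\<lambda>j. 4 * B j * ?w \<delta>)"
        by (rule summable_mult2[OF summable_mult[OF summ_B]])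
    qed
    moreover have "continuous_on {\<delta>..\<eta>} (\<lambda>t. \<Sum>j<n. T j t * ?w t)" for n
    proof (intro continuous_on_sum continuous_on_mult)
      fix j
      have "continuous_on {\<delta>..\<eta>} (\<lambda>t. \<bar>\<alpha> j + t * b\<bar> powr q)" for b
        using p by (intro continuous_on_powr' continuous_intros) auto
      from this[of "\<beta> j"] this[of "- \<beta> j"] show "continuous_on {\<delta>..\<eta>} (T j)"
        unfolding T_eq[abs_def] by (auto intro!: continuous_intros)
      show "continuous_on {\<delta>..\<eta>} ?w"
        using \<delta> by (intro continuous_intros) auto
    qed
    ultimately obtain I J where
      I: "\<And>n. ((\<lambda>t. \<Sum>j<n. T j t * ?w t) has_integral I n) {\<delta>..\<eta>}" and
      J: "((\<lambda>t. \<Sum>j. T j t * ?w t) has_integral J) {\<delta>..\<eta>}" and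
      IJ: "I \<longlonglongrightarrow> J"
      by (rule uniform_limit_integral) auto

    \<comment> \<open>Lower bound for the integral\<close>
    have "\<exists>i. ((\<lambda>t. T j t * ?w t) has_integral i) {\<delta>..\<eta>} \<and> - K j \<le> i" for j
    proof -
      obtain i where i: "((\<lambda>t. (\<bar>\<alpha> j + t * \<beta> j\<bar> powr q + \<bar>\<alpha> j - t * \<beta> j\<bar> powr q
          - 2 * \<bar>\<alpha> j\<bar> powr q) * ?w t) has_integral i) {\<delta>..\<eta>}"
        "- (2 / \<eta> * (\<bar>\<alpha> j\<bar> / \<eta> + \<bar>\<beta> j\<bar>) powr q) \<le> i"
        using has_integral_second_difference[of q \<delta> \<eta> "\<alpha> j" "\<beta> j"] \<delta> p by force
      have "((\<lambda>t. T j t * ?w t) has_integral \<beta> j ^ (2 * k) * i) {\<delta>..\<eta>}"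
        unfolding T_eq mult.assoc using i(1) by (rule has_integral_mult_right)
      moreover have "- K j \<le> \<beta> j ^ (2 * k) * i"
        using mult_left_mono[OF i(2), of "\<beta> j ^ (2 * k)"] by (simp add: K_def)
      ultimately show ?thesis
        by blast
    qed
    then obtain i where i: "\<And>j. ((\<lambda>t. T j t * ?w t) has_integral i j) {\<delta>..\<eta>}" "\<And>j. - K j \<le> i j"
      by metis
    have "((\<lambda>t. T m t * ?w t) has_integral 2 * c * (1 / \<delta> - 1 / \<eta>)) {\<delta>..\<eta>}"
    proof -
      have e: "T m t * ?w t = 2 * \<beta> m ^ (2 * k) * (\<bar>t * \<beta> m\<bar> powr q * ?w t)" for t
        by (simp add: T_eq m(1))
      have "((\<lambda>t. 2 * \<beta> m ^ (2 * k) * (\<bar>t * \<beta> m\<bar> powr q * ?w t)) has_integral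
          2 * \<beta> m ^ (2 * k) * (\<bar>\<beta> m\<bar> powr q * (1 / \<delta> - 1 / \<eta>))) {\<delta>..\<eta>}"
        using \<delta> by (intro has_integral_mult_right has_integral_powr_weighted) auto
      then show ?thesis
        unfolding e c_def by (simp only: mult.assoc)
    qed
    then have i_m: "i m = 2 * c * (1 / \<delta> - 1 / \<eta>)"
      using i(1) has_integral_unique by blast

    \<comment> \<open>Once \<open>n\<close> exceeds \<open>m\<close>, the partial sum contains the
      singular term. All its other terms together cost at most \<open>suminf K\<close>, and this
      survives the limit in \<open>n\<close>.\<close>
    have "2 * c * (1 / \<delta> - 1 / \<eta>) - suminf K \<le> I n" if "m < n" for n
    proof -
      have "((\<lambda>t. \<Sum>j<n. T j t * ?w t) has_integral (\<Sum>j<n. i j)) {\<delta>..\<eta>}"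
        by (intro has_integral_sum i) auto
      then have "I n = (\<Sum>j<n. i j)"
        using I has_integral_unique by blast
      also have "\<dots> = i m + (\<Sum>j\<in>{..<n} - {m}. i j)"
        using that by (intro sum.remove) auto
      finally have "I n = i m + (\<Sum>j\<in>{..<n} - {m}. i j)" .
      moreover have "(\<Sum>j\<in>{..<n} - {m}. - K j) \<le> (\<Sum>j\<in>{..<n} - {m}. i j)"
        by (intro sum_mono i(2))
      moreover have "(\<Sum>j\<in>{..<n} - {m}. K j) \<le> suminf K"
        using K_nonneg by (intro sum_le_suminf summ_K) auto
      ultimately show ?thesis
        by (simp add: i_m sum_negf)
    qed
    then have lower: "2 * c * (1 / \<delta> - 1 / \<eta>) - suminf K \<le> J"
      using IJ by (intro tendsto_lowerbound[OF IJ]) (auto intro: eventually_mono[OF eventually_gt_at_top[of m]])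

    \<comment> \<open>Upper bound from C^2 regularity\<close>
    have "((\<lambda>t. \<bar>M\<bar> * t powr (- \<theta>)) has_integral
        (\<bar>M\<bar> / (1 - \<theta>) * \<eta> powr (1 - \<theta>) - \<bar>M\<bar> / (1 - \<theta>) * \<delta> powr (1 - \<theta>))) {\<delta>..\<eta>}"
    proof (rule fundamental_theorem_of_calculus)
      fix t assume t: "t \<in> {\<delta>..\<eta>}"
      have "((\<lambda>t. \<bar>M\<bar> / (1 - \<theta>) * t powr (1 - \<theta>)) has_real_derivative
          \<bar>M\<bar> / (1 - \<theta>) * ((1 - \<theta>) * t powr (1 - \<theta> - 1))) (at t)"
        using t \<delta> by (intro DERIV_cmult has_real_derivative_powr) auto
      also have "\<bar>M\<bar> / (1 - \<theta>) * ((1 - \<theta>) * t powr (1 - \<theta> - 1)) = \<bar>M\<bar> * t powr (- \<theta>)"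
        using \<theta>(1) by simp
      finally show "((\<lambda>t. \<bar>M\<bar> / (1 - \<theta>) * t powr (1 - \<theta>)) has_vector_derivative \<bar>M\<bar> * t powr (- \<theta>))
          (at t within {\<delta>..\<eta>})"
        unfolding has_real_derivative_iff_has_vector_derivative[symmetric]
        by (rule has_field_derivative_at_within)
    qed (use \<delta> in simp)
    \<comment> \<open>The sum is the weighted second difference of \<open>g\<close>, where
      \<open>t ^ 2\<close> cancels part of the weight. Replacing \<open>M\<close> by
      \<open>\<bar>M\<bar>\<close> keeps the later change of exponent monotone.\<close>
    moreover have "(\<Sum>j. T j t * ?w t) \<le> \<bar>M\<bar> * t powr (- \<theta>)" if t: "t \<in> {\<delta>..\<eta>}" for t
    proof -
      have "0 < t" "t \<le> 1"
        using t \<delta> \<eta> by auto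
      have "summable (\<lambda>j. T j t)"
        by (rule summable_comparison_test'[OF summable_mult[OF summ_B, of 4]])
           (use T_le \<open>0 < t\<close> \<open>t \<le> 1\<close> in auto)
      then have "(\<Sum>j. T j t * ?w t) = (g t + g (- t) - 2 * g 0) * ?w t"
        using \<open>0 < t\<close> \<open>t \<le> 1\<close> by (simp add: suminf_mult2[symmetric] T_suminf)
      also have "\<dots> \<le> (\<bar>M\<bar> * t ^ 2) * ?w t"
      proof (intro mult_right_mono)
        have "g t + g (- t) - 2 * g 0 \<le> M * t ^ 2"
          using t \<delta> by (intro M) auto
        also have "\<dots> \<le> \<bar>M\<bar> * t ^ 2"
          by (intro mult_right_mono) auto
        finally show "g t + g (- t) - 2 * g 0 \<le> \<bar>M\<bar> * t ^ 2" .
      qed simp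
      also have "\<dots> = \<bar>M\<bar> * t powr (- q)"
        using \<open>0 < t\<close> by (simp add: powr_diff)
      also have "\<dots> \<le> \<bar>M\<bar> * t powr (- \<theta>)"
        using \<open>0 < t\<close> \<open>t \<le> 1\<close> \<theta> by (intro mult_left_mono powr_mono') auto
      finally show ?thesis .
    qed
    ultimately have "J \<le> \<bar>M\<bar> / (1 - \<theta>) * \<eta> powr (1 - \<theta>) - \<bar>M\<bar> / (1 - \<theta>) * \<delta> powr (1 - \<theta>)"
      by (rule has_integral_le[OF J])
    also have "\<bar>M\<bar> / (1 - \<theta>) = - L"
      using \<theta>(1) by (simp add: L_def divide_simps algebra_simps)
    also have "- L * \<eta> powr (1 - \<theta>) - - L * \<delta> powr (1 - \<theta>) \<le> L * \<delta> powr (1 - \<theta>)"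
      using \<theta>(1) by (simp add: L_def)
    finally have "2 * c * (1 / \<delta> - 1 / \<eta>) - suminf K \<le> L * \<delta> powr (1 - \<theta>)"
      using lower by linarith
    then have "(2 * c * (1 / \<delta> - 1 / \<eta>) - suminf K) * \<delta> \<le> L * \<delta> powr (1 - \<theta>) * \<delta>"
      using \<delta> by (intro mult_right_mono) auto
    also have "L * \<delta> powr (1 - \<theta>) * \<delta> = L * \<delta> powr (2 - \<theta>)"
      using \<delta> powr_add[of \<delta> "1 - \<theta>" 1] by simp
    also have "(2 * c * (1 / \<delta> - 1 / \<eta>) - suminf K) * \<delta> = 2 * c - (2 * c / \<eta> + suminf K) * \<delta>"
      using \<delta> by (simp add: algebra_simps)
    finally show ?thesis
      by simp
  qed
  \<comment> \<open>Letting \<open>\<delta>\<close> decrease to \<open>0\<close> in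
    \<open>bound\<close> removes the whole right side, since \<open>2 - \<theta> > 0\<close>, and
    leaves \<open>2 * c \<le> 0\<close>.\<close>
  have "((\<lambda>\<delta>. (2 * c / \<eta> + suminf K) * \<delta> + L * \<delta> powr (2 - \<theta>)) \<longlongrightarrow>
      (2 * c / \<eta> + suminf K) * 0 + L * 0 powr (2 - \<theta>)) (at_right 0)"
    using \<theta>(2) by (intro tendsto_intros) (auto simp: eventually_at_filter)
  moreover have "eventually (\<lambda>\<delta>. 2 * c \<le> (2 * c / \<eta> + suminf K) * \<delta> + L * \<delta> powr (2 - \<theta>)) (at_right 0)"
    unfolding eventually_at_right_field using bound \<eta>(1) by blast
  ultimately have "2 * c \<le> (2 * c / \<eta> + suminf K) * 0 + L * 0 powr (2 - \<theta>)"
    by (intro tendsto_lowerbound) auto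
  with \<open>0 < c\<close> show False
    by simp
qed

subsection \<open>Restriction of the norm to a line\<close>

text \<open>Smoothness is known only on the sphere, so the line is projected radially to the curve
  \<open>\<gamma>\<close>, and homogeneity restores the factor
  \<open>norm (x + s *\<^sub>R u)\<close>. This factor is smooth as a power of the positive
  quadratic polynomial \<open>Q\<close>.\<close>

lemma Ck_real_norm_powr_line:
  fixes x u :: "'a::euclidean_space"
  assumes N: "is_norm N" "Ck_on_submanifold k (sphere 0 1) N"
    and x: "norm x = 1" and line: "\<And>s. x + s *\<^sub>R u \<noteq> 0"
  obtains V where "open V" "(0::real) \<in> V" "Ck_real k V (\<lambda>s. N (x + s *\<^sub>R u) powr p)"
proof -
  have "x \<in> sphere 0 1"
    using x by simp
  with N(2) obtain U G where U: "open U" "x \<in> U" "Ck_on k U G" "\<And>y. y \<in> sphere 0 1 \<inter> U \<Longrightarrow> G y = N y"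
    unfolding Ck_on_submanifold_def by meson
  define Q where "Q s = (norm (x + s *\<^sub>R u))\<^sup>2" for s
  have Q_pos: "0 < Q s" for s
    using line by (simp add: Q_def)
  have Q_poly: "Q s = 1 + (2 * (x \<bullet> u)) * s + ((norm u)\<^sup>2 * s) * s" for s
    using x by (simp add: Q_def power2_norm_eq_inner inner_add_left inner_add_right inner_commute
        norm_eq_1 algebra_simps)
  have sqrt_Q: "Q s powr (1 / 2) = norm (x + s *\<^sub>R u)" for s
    using powr_half_sqrt[of "Q s"] Q_pos[of s] by (simp add: Q_def)
  define A where "A s = Q s powr (- 1 / 2)" for s
  have A_eq: "A s = 1 / norm (x + s *\<^sub>R u)" for s
    using sqrt_Q[of s] powr_minus_divide[of "Q s" "1 / 2"] by (simp add: A_def)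
  define \<gamma> where "\<gamma> s = A s *\<^sub>R x + (A s * s) *\<^sub>R u" for s
  have \<gamma>_eq: "\<gamma> s = (1 / norm (x + s *\<^sub>R u)) *\<^sub>R (x + s *\<^sub>R u)" for s
    by (simp add: \<gamma>_def A_eq scaleR_add_right)
  have \<gamma>_sphere: "\<gamma> s \<in> sphere 0 1" for s
    using line[of s] by (simp add: \<gamma>_eq)
  define V where "V = \<gamma> -` U"
  have "continuous_on UNIV \<gamma>"
    unfolding \<gamma>_eq[abs_def] using line by (intro continuous_intros) auto
  then have "open V"
    using U(1) unfolding V_def by (rule open_vimage[rotated])
  have "0 \<in> V"
    using U(2) x by (simp add: V_def \<gamma>_eq)
  have CQ: "Ck_real k V Q"
    unfolding Q_poly[abs_def] by (intro Ck_real_add Ck_real_mult Ck_real_const Ck_real_ident)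
  then have CA: "Ck_real k V A"
    unfolding A_def[abs_def] using Q_pos by (rule Ck_real_powr)
  have CG: "Ck_real k V (\<lambda>s. G (\<gamma> s))"
    unfolding \<gamma>_def
    by (rule Ck_real_comp_Ck_on[OF U(3) CA Ck_real_mult[OF CA Ck_real_ident]])
       (simp add: V_def \<gamma>_def)
  have N_eq: "N (x + s *\<^sub>R u) = Q s powr (1 / 2) * G (\<gamma> s)" if "s \<in> V" for s
  proof -
    have "G (\<gamma> s) = N (\<gamma> s)"
      using U(4) \<gamma>_sphere that by (simp add: V_def)
    also have "\<dots> = 1 / norm (x + s *\<^sub>R u) * N (x + s *\<^sub>R u)"
      using N(1) unfolding \<gamma>_eq is_norm_def by simp
    finally show ?thesis
      using line[of s] by (simp add: sqrt_Q)
  qed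
  have N_pos: "0 < N y" if "y \<noteq> 0" for y
    using N(1) that unfolding is_norm_def by (metis order_le_less)
  have "Ck_real k V (\<lambda>s. Q s powr (1 / 2) * G (\<gamma> s))"
    using Q_pos by (intro Ck_real_mult Ck_real_powr CQ CG)
  \<comment> \<open>On \<open>V\<close> the base equals the norm of a nonzero vector, hence is
    positive, as \<open>Ck_real_powr\<close> requires.\<close>
  then have "Ck_real k V (\<lambda>s. (Q s powr (1 / 2) * G (\<gamma> s)) powr p)"
    by (rule Ck_real_powr) (use N_eq N_pos line in metis)
  then have "Ck_real k V (\<lambda>s. N (x + s *\<^sub>R u) powr p)"
    using N_eq by (subst Ck_real_cong[OF \<open>open V\<close>]) auto
  with that \<open>open V\<close> \<open>0 \<in> V\<close> show ?thesis
    by blast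
qed

text \<open>The kernel is the orthogonal complement of \<open>adjoint l 1\<close>, which is nonzero
  in dimension at least two.\<close>

lemma exists_unit_vector_in_kernel:
  fixes l :: "'a::euclidean_space \<Rightarrow> real"
  assumes "linear l" "2 \<le> DIM('a)"
  obtains x where "norm x = 1" "l x = 0"
proof -
  interpret linear l by fact
  obtain y where y: "y \<noteq> 0" "orthogonal (adjoint l 1) y"
    using orthogonal_to_vector_exists[OF assms(2), of "adjoint l 1"] by blast
  have "l y = 0"
    using y(2) adjoint_works[OF assms(1), of y 1] by (simp add: orthogonal_def inner_commute)
  then show ?thesis
    using that[of "sgn y"] y(1) by (simp add: norm_sgn sgn_div_norm scale)
qed

text \<open>Dimension one is excluded because there every norm is a multiple of the absolute value
  and embeds as a line.\<close>

theorem proposition2: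
  fixes p :: real and r :: nat and N :: "real ^ 'n \<Rightarrow> real"
  assumes "CARD('n) \<ge> 2"
    and "p \<ge> 1"
    and "\<not> (\<exists>k::nat. p = 2 * real k)"
    and "is_norm N"
    and "Ck_on_submanifold (2 * r) (sphere (0 :: real ^ 'n) 1) N"
    and "2 * real r > real CARD('n) + p"
  shows "\<not> embeds_isometrically_in_ell N p"
proof
  assume "embeds_isometrically_in_ell N p"
  then obtain T :: "real ^ 'n \<Rightarrow> nat \<Rightarrow> real" where
    T_ell: "\<And>x. T x \<in> ell p" and
    T_add: "\<And>x y. T (x + y) = (\<lambda>j. T x j + T y j)" and
    T_scale: "\<And>c x. T (c *\<^sub>R x) = (\<lambda>j. c * T x j)" and
    T_norm: "\<And>x. ell_norm p (T x) = N x"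
    unfolding embeds_isometrically_in_ell_def by auto
  have summ: "summable (\<lambda>j. \<bar>T x j\<bar> powr p)" for x
    using T_ell[of x] by (simp add: ell_def)
  have N_powr: "N x powr p = (\<Sum>j. \<bar>T x j\<bar> powr p)" for x
    unfolding T_norm[of x, symmetric] ell_norm_def
    using assms(2) by (simp add: powr_powr suminf_nonneg[OF summ])
  have lin: "linear (\<lambda>x. T x j)" for j
    by (rule linearI) (simp_all add: T_add T_scale)
  obtain u :: "real ^ 'n" where "u \<noteq> 0"
    using vector_choose_size[of 1] by (metis norm_zero zero_le_one zero_neq_one)
  then have "N u powr p \<noteq> 0"
    using assms(4) by (simp add: is_norm_def)
  then obtain m where m: "T u m \<noteq> 0"
    unfolding N_powr by fastforce
  \<comment> \<open>The base point lies in the kernel of a coordinate that does not vanish at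
    \<open>u\<close>. Hence that coordinate is zero on the line only at \<open>s = 0\<close>, where
    the point is \<open>x \<noteq> 0\<close>.\<close>
  obtain x where x: "norm x = 1" "T x m = 0"
    using exists_unit_vector_in_kernel[OF lin[of m]] assms(1) by auto
  have line: "x + s *\<^sub>R u \<noteq> 0" for s
  proof
    assume *: "x + s *\<^sub>R u = 0"
    have "T (x + s *\<^sub>R u) m = s * T u m"
      by (simp add: T_add T_scale x(2))
    moreover have "T (x + s *\<^sub>R u) m = 0"
      unfolding * using linear_0[OF lin[of m]] .
    ultimately show False
      using * m x(1) by simp
  qed

  \<comment> \<open>Removing the largest multiple of \<open>2\<close> leaves
    \<open>0 \<le> q < 2\<close>; the value \<open>q = 0\<close> would make \<open>p\<close> an even
    integer.\<close>
  define k where "k = nat \<lfloor>p / 2\<rfloor>"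
  define q where "q = p - 2 * real k"
  have "real k = of_int \<lfloor>p / 2\<rfloor>"
    using assms(2) by (simp add: k_def)
  then have "0 \<le> q" "q < 2"
    unfolding q_def by linarith+
  moreover have "q \<noteq> 0"
    using assms(3) unfolding q_def by auto
  ultimately have q: "p = 2 * real k + q" "0 < q" "q < 2"
    by (auto simp: q_def)
  \<comment> \<open>Since \<open>q > 0\<close> and the dimension is at least two,
    \<open>2 * k + 2 < p + 2 \<le> p + CARD('n) < 2 * r\<close>.\<close>
  have "real (2 * k + 2) \<le> real (2 * r)"
    using assms(1,6) q by simp
  then have "2 * k + 2 \<le> 2 * r"
    unfolding of_nat_le_iff .

  obtain V where V: "open V" "(0::real) \<in> V" "Ck_real (2 * r) V (\<lambda>s. N (x + s *\<^sub>R u) powr p)"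
    using Ck_real_norm_powr_line[OF assms(4,5) x(1) line] by blast
  have "Ck_real (2 * k + 2) V (\<lambda>s. \<Sum>j. \<bar>T x j + s * T u j\<bar> powr p)"
    using Ck_real_mono[OF V(3) \<open>2 * k + 2 \<le> 2 * r\<close>] by (simp add: N_powr T_add T_scale)
  with line_series_not_Ck[OF summ summ q V(1,2) x(2) m] show False
    by blast
qed

end
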